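(* For any polynomial $P_n$ with complex coefficients of degree at most $n$, we have $$e^{-n/2} M(P_n) \le \|P_n\|_0 \le M(P_n).$$ Equality holds in the lower estimate $e^{-n/2} M(P_n) \le \|P_n\|_0$ if and only if $P_n(z)= a_n z^n$ for some $a_n\in\mathbb{C}$. Equality holds in the upper estimate $\|P_n\|_0\le M(P_n)$ for any polynomial $P_n$ without zeros in the unit disk $\mathbb{D}$.
   Context: $\mathbb{D}=\{z\in\mathbb{C}:|z|<1\}$ is the open unit disk and $dA$ is the area (Lebesgue) measure. For a polynomial $P$ with complex coefficients, Mahler's measure is $$M(P) := \exp\left(\frac{1}{2\pi}\int_0^{2\pi}\log|P(e^{i\theta})|\,d\theta\right),$$ and its areal analog is $$\|P\|_0 := \exp\left(\frac{1}{\pi}\iint_{\mathbb{D}}\log|P(z)|\,dA\right).$$ For the zero polynomial both quantities are understood to be $0$. *)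

theory Defs
  imports "HOL-Analysis.Analysis" "HOL-Computational_Algebra.Polynomial"
begin

(* Both logarithms have at most finitely many singularities on the domain of integration
   when P is nonzero; there ln 0 = 0 in HOL, which changes the integrand only on a null set.
   The zero polynomial is a separate case because the integrals below would give exp 0 = 1. *)

definition mahler_measure :: "complex poly \<Rightarrow> real" where
  "mahler_measure P =
     (if P = 0 then 0
      else exp (1 / (2 * pi) * (LINT t:{0..2 * pi}|lborel. ln (cmod (poly P (exp (\<i> * of_real t)))))))"

definition areal_mahler_measure :: "complex poly \<Rightarrow> real" where
  "areal_mahler_measure P =
     (if P = 0 then 0
      else exp (1 / pi * (LINT z:ball 0 1|lborel. ln (cmod (poly P z)))))"

end

theory Submission
  imports Defs "HOL-Complex_Analysis.Complex_Analysis"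
    "HOL-Computational_Algebra.Fundamental_Theorem_Algebra"
begin

text \<open>Factor \<open>P\<close> into linear factors. A root \<open>w\<close> contributes \<open>ln (max 1 (cmod w))\<close> to the logarithm of
  Mahler's measure (Jensen's formula), while to the logarithm of the areal measure it contributes
  \<open>ln (cmod w)\<close> if \<open>cmod w \<ge> 1\<close> and \<open>((cmod w)\<^sup>2 - 1) / 2\<close> otherwise. The difference of the two
  contributions lies between \<open>0\<close> and \<open>1 / 2\<close>; it vanishes for \<open>cmod w \<ge> 1\<close> and equals \<open>1 / 2\<close>
  only for \<open>w = 0\<close>.\<close>

section \<open>Invariance of Lebesgue measure under translations and orthogonal maps\<close>

lemma nn_integral_lborel_translate:
  fixes h :: "'a::euclidean_space \<Rightarrow> ennreal"
  assumes [measurable]: "h \<in> borel_measurable borel"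
  shows "(\<integral>\<^sup>+x. h (c + x) \<partial>lborel) = (\<integral>\<^sup>+x. h x \<partial>lborel)"
  by (subst (2) lborel_distr_plus[of c, symmetric], subst nn_integral_distr) auto

text \<open>Multiplying by the indicator of the unit ball in a second variable, translating in both
  variables and using Fubini reduces the claim to the invariance of the ball under \<open>f\<close>.\<close>

lemma nn_integral_lborel_orthogonal:
  fixes f :: "'a::euclidean_space \<Rightarrow> 'a" and h :: "'a \<Rightarrow> ennreal"
  assumes f: "orthogonal_transformation f" and [measurable]: "h \<in> borel_measurable borel"
  shows "(\<integral>\<^sup>+x. h (f x) \<partial>lborel) = (\<integral>\<^sup>+x. h x \<partial>lborel)"
proof -
  have lin: "linear f" and norm_f: "\<And>x. norm (f x) = norm x"
    using f by (auto simp: orthogonal_transformation)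
  have [measurable]: "f \<in> borel_measurable borel"
    using lin by (intro borel_measurable_continuous_onI linear_continuous_on)
      (simp add: linear_conv_bounded_linear)
  define B where "B = ball (0::'a) 1"
  have [measurable]: "B \<in> sets borel" by (simp add: B_def)
  have shift: "\<exists>g. f g = y" for y
    using orthogonal_transformation_surj[OF f] by (metis surjD)
  have B_fin: "emeasure lborel B \<noteq> top" "emeasure lborel B \<noteq> 0"
    using emeasure_ball[of 1 "0::'a"] unit_ball_vol_pos[of "real DIM('a)"]
    by (simp_all add: B_def del: unit_ball_vol_pos)
  have "(\<integral>\<^sup>+x. h (f x) \<partial>lborel) * emeasure lborel B
      = (\<integral>\<^sup>+x. (\<integral>\<^sup>+y. h (f x) * indicator B y \<partial>lborel) \<partial>lborel)"
    by (simp add: nn_integral_cmult nn_integral_multc)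
  also have "\<dots> = (\<integral>\<^sup>+x. (\<integral>\<^sup>+y. h (f x) * indicator B (- f x + y) \<partial>lborel) \<partial>lborel)"
    by (intro nn_integral_cong nn_integral_lborel_translate[symmetric]) measurable
  also have "\<dots> = (\<integral>\<^sup>+y. (\<integral>\<^sup>+x. h (f x) * indicator B (- f x + y) \<partial>lborel) \<partial>lborel)"
    by (intro lborel_pair.Fubini') measurable
  also have "\<dots> = (\<integral>\<^sup>+y. (\<integral>\<^sup>+x. h (f x + y) * indicator B (- f x) \<partial>lborel) \<partial>lborel)"
  proof (rule nn_integral_cong)
    \<comment> \<open>Shift \<open>x\<close> by a preimage \<open>g\<close> of \<open>y\<close>: by
      linearity \<open>f (g + x) = y + f x\<close>, so \<open>y\<close> leaves the indicator and
      enters the argument of \<open>h\<close>.\<close>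
    fix y :: 'a
    obtain g where g: "f g = y" using shift by blast
    have "(\<integral>\<^sup>+x. h (f x) * indicator B (- f x + y) \<partial>lborel)
        = (\<integral>\<^sup>+x. h (f (g + x)) * indicator B (- f (g + x) + y) \<partial>lborel)"
      by (rule nn_integral_lborel_translate[symmetric]) measurable
    then show "(\<integral>\<^sup>+x. h (f x) * indicator B (- f x + y) \<partial>lborel)
        = (\<integral>\<^sup>+x. h (f x + y) * indicator B (- f x) \<partial>lborel)"
      by (simp add: linear_add[OF lin] g add.commute)
  qed
  also have "\<dots> = (\<integral>\<^sup>+x. (\<integral>\<^sup>+y. h (f x + y) * indicator B (- f x) \<partial>lborel) \<partial>lborel)"
    by (intro lborel_pair.Fubini') measurable
  \<comment> \<open>Translation in \<open>y\<close> removes \<open>f x\<close>, and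
    \<open>- f x\<close> lies in \<open>B\<close> exactly when \<open>x\<close> does, because
    \<open>f\<close> preserves norms.\<close>
  also have "\<dots> = (\<integral>\<^sup>+x. (\<integral>\<^sup>+y. h y \<partial>lborel) * indicator B x \<partial>lborel)"
    by (intro nn_integral_cong)
      (simp add: nn_integral_multc nn_integral_lborel_translate B_def indicator_def norm_f)
  also have "\<dots> = (\<integral>\<^sup>+y. h y \<partial>lborel) * emeasure lborel B"
    by (simp add: nn_integral_cmult)
  finally show ?thesis
    using B_fin by (simp add: mult.commute[of _ "emeasure lborel B"] ennreal_mult_cancel_left)
qed

text \<open>Multiplication by a number of modulus 1 is an orthogonal map of the real plane.\<close>

lemma nn_integral_lborel_rotate:
  fixes h :: "complex \<Rightarrow> ennreal"
  assumes "cmod c = 1" "h \<in> borel_measurable borel"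
  shows "(\<integral>\<^sup>+z. h (z * c) \<partial>lborel) = (\<integral>\<^sup>+z. h z \<partial>lborel)"
  using assms
  by (intro nn_integral_lborel_orthogonal)
    (auto simp: orthogonal_transformation norm_mult intro!: bounded_linear.linear bounded_linear_mult_left)

section \<open>Jensen's formula for a linear factor on a circle\<close>

text \<open>On the closed unit disc \<open>1 - q * z\<close> has positive real part, so its
  principal logarithm is holomorphic there. Cauchy's formula equates the mean of this logarithm over
  the unit circle with its value \<open>Ln 1 = 0\<close> at the centre.\<close>

lemma has_bochner_integral_ln_cmod_one_minus_cis:
  assumes q: "cmod q < 1"
  shows "has_bochner_integral lborel
    (\<lambda>t. indicator {0..2 * pi} t *\<^sub>R ln (cmod (1 - q * cis t))) 0"
proof -
  have pos: "1 - q * z \<notin> \<real>\<^sub>\<le>\<^sub>0" if "cmod z \<le> 1" for z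
  proof -
    have "cmod (q * z) < 1"
      using mult_left_mono[OF that, of "cmod q"] q by (simp add: norm_mult)
    then have "Re (q * z) < 1"
      using complex_Re_le_cmod[of "q * z"] by linarith
    then show ?thesis by (auto simp: complex_nonpos_Reals_iff)
  qed
  have nz: "1 - q * cis t \<noteq> 0" for t
    using pos[of "cis t"] by auto
  have "(\<lambda>z. Ln (1 - q * z)) holomorphic_on cball 0 1"
    using pos by (auto intro!: holomorphic_intros)
  from Cauchy_integral_circlepath_simple[OF this, of 0]
  have "((\<lambda>u. Ln (1 - q * u) / u) has_contour_integral 0) (part_circlepath 0 1 0 (2 * pi))"
    by (simp add: circlepath_def)
  then have "((\<lambda>t. Ln (1 - q * cis t) * \<i>) has_integral 0) {0..2 * pi}"
    by (subst (asm) has_contour_integral_part_circlepath_iff) auto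
  \<comment> \<open>The imaginary part of \<open>Ln u * \<i>\<close> is the real part of
    \<open>Ln u\<close>, that is \<open>ln (cmod u)\<close>.\<close>
  from has_integral_linear[OF this bounded_linear_Im]
  have hi: "((\<lambda>t. ln (cmod (1 - q * cis t))) has_integral 0) {0..2 * pi}"
    using nz by (simp add: o_def)
  have int: "set_integrable lborel {0..2 * pi} (\<lambda>t. ln (cmod (1 - q * cis t)))"
    by (intro borel_integrable_atLeastAtMost' continuous_intros) (use nz in auto)
  show ?thesis
    using int set_borel_integral_eq_integral(2)[OF int] integral_unique[OF hi]
    by (simp add: has_bochner_integral_iff set_integrable_def set_lebesgue_integral_def)
qed

lemma has_bochner_integral_interval_const:
  fixes c :: real
  assumes "a \<le> b"
  shows "has_bochner_integral lborel (\<lambda>t. indicator {a..b} t *\<^sub>R c) ((b - a) * c)"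
  using has_bochner_integral_mult_left[OF has_bochner_integral_real_indicator[of "{a..b}" lborel], of c] assms
  by simp

text \<open>Pulling out the factor of larger modulus \<open>m\<close> leaves
  \<open>cmod (1 - q * cis t)\<close> with \<open>cmod q < 1\<close>. The logarithm of that
  integrates to 0, so only the constant \<open>ln m\<close> contributes.\<close>

lemma has_bochner_integral_ln_cmod_circle_noncritical:
  assumes "cmod a \<noteq> cmod w"
  shows "has_bochner_integral lborel
    (\<lambda>t. indicator {0..2 * pi} t *\<^sub>R ln (cmod (a * cis t - w))) (2 * pi * ln (max (cmod a) (cmod w)))"
proof -
  define m where "m = max (cmod a) (cmod w)"
  have "m > 0"
    using assms unfolding m_def by (smt (verit) norm_ge_zero)
  have "\<exists>q. cmod q < 1 \<and> (\<forall>t. cmod (a * cis t - w) = m * cmod (1 - q * cis t))"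
  proof (cases "cmod a < cmod w")
    case True
    then have w: "w \<noteq> 0" by auto
    have "cmod (a * cis t - w) = m * cmod (1 - (a / w) * cis t)" for t
    proof -
      have "a * cis t - w = - w * (1 - (a / w) * cis t)" using w by (simp add: field_simps)
      then show ?thesis using True by (simp only: norm_mult m_def) simp
    qed
    moreover have "cmod (a / w) < 1" using True w by (simp add: norm_divide divide_less_eq)
    ultimately show ?thesis by blast
  next
    case False
    then have a: "a \<noteq> 0" and lt: "cmod w < cmod a" using assms by auto
    have "cmod (a * cis t - w) = m * cmod (1 - cnj (w / a) * cis t)" for t
    proof -
      have "a * cis t - w = a * cis t * (1 - (w / a) * cis (-t))"
        using a by (simp add: field_simps flip: cis_inverse)
      then have "cmod (a * cis t - w) = m * cmod (1 - (w / a) * cis (-t))"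
        using lt by (simp only: norm_mult m_def) simp
      \<comment> \<open>Conjugation turns \<open>cis (-t)\<close> into \<open>cis t\<close>, which
        gives the same form as in the first case.\<close>
      also have "cmod (1 - (w / a) * cis (-t)) = cmod (cnj (1 - (w / a) * cis (-t)))"
        by (simp only: complex_mod_cnj)
      finally show ?thesis by (simp add: cis_cnj)
    qed
    moreover have "cmod (cnj (w / a)) < 1" using lt a by (simp add: norm_divide divide_less_eq)
    ultimately show ?thesis by blast
  qed
  then obtain q where q: "cmod q < 1" and eq: "\<And>t. cmod (a * cis t - w) = m * cmod (1 - q * cis t)"
    by blast
  have nz: "1 - q * cis t \<noteq> 0" for t
    using q by (metis eq_iff_diff_eq_0 less_irrefl mult.right_neutral norm_cis norm_mult norm_one)
  show ?thesis
    using has_bochner_integral_add[OF has_bochner_integral_interval_const[of 0 "2 * pi" "ln m"]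
        has_bochner_integral_ln_cmod_one_minus_cis[OF q]] nz \<open>m > 0\<close>
    by (simp add: eq ln_mult distrib_left m_def[symmetric])
qed

text \<open>On the half-open interval \<open>cis\<close> is injective, so at most one angle there is
  hit; the endpoint \<open>2 * pi\<close> is added by hand. This discards the singularities, where
  \<open>ln 0 = 0\<close> takes over.\<close>

lemma AE_cis_neq: "AE t in lborel. t \<in> {0..2 * pi} \<longrightarrow> cis t \<noteq> w"
proof -
  have "finite (cis -` {w} \<inter> {0..<2 * pi})"
  proof (intro finite_vimage_IntI inj_onI)
    fix s t :: real
    assume "s \<in> {0..<2 * pi}" "t \<in> {0..<2 * pi}" "cis s = cis t"
    then show "s = t"
      using exp_complex_eqI[of "\<i> * of_real s" "\<i> * of_real t"] by (auto simp: cis_conv_exp)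
  qed auto
  then have "finite (insert (2 * pi) (cis -` {w} \<inter> {0..<2 * pi}))" by simp
  then have "AE t in lborel. t \<notin> insert (2 * pi) (cis -` {w} \<inter> {0..<2 * pi})"
    by (intro AE_not_in finite_imp_null_set_lborel)
  then show ?thesis by eventually_elim auto
qed

text \<open>Here \<open>w\<close> is approached radially from inside. Fatou gives integrability, and for
  \<open>0 < r < 1\<close> one has \<open>cmod (cis t - w) \<le> 2 * cmod (cis t - r * w)\<close>, so that dominated
  convergence applies.\<close>

lemma has_bochner_integral_ln_cmod_unit_circle_critical:
  assumes w: "cmod w = 1"
  shows "has_bochner_integral lborel
    (\<lambda>t. indicator {0..2 * pi} t *\<^sub>R ln (cmod (cis t - w))) 0"
proof -
  \<comment> \<open>The offset 2 keeps \<open>r 0 = 1 / 2\<close> strictly positive.\<close>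
  define r where "r n = 1 - 1 / real (n + 2)" for n
  have r: "0 < r n" "r n < 1" for n by (auto simp: r_def field_simps)
  have r_lim: "r \<longlonglongrightarrow> 1"
    unfolding r_def by real_asymp
  \<comment> \<open>For \<open>cmod v \<le> 1\<close> the distance \<open>cmod (cis t - v)\<close>
    is at most 2. Subtracting from \<open>ln 2\<close> thus gives a nonnegative function, as Fatou's
    lemma requires.\<close>
  define G where "G v t = indicator {0..2 * pi} t *\<^sub>R (ln 2 - ln (cmod (cis t - v)))" for v t
  have [measurable]: "G v \<in> borel_measurable lborel" for v
  proof -
    have [measurable]: "cis \<in> borel_measurable borel"
      by (intro borel_measurable_continuous_onI continuous_intros)
    show ?thesis unfolding G_def by measurable
  qed
  have const: "has_bochner_integral lborel (\<lambda>t. indicator {0..2 * pi} t *\<^sub>R ln 2) (2 * pi * ln 2)"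
    using has_bochner_integral_interval_const[of 0 "2 * pi" "ln 2"] by simp
  \<comment> \<open>The value does not depend on \<open>n\<close>: the logarithmic term integrates
    to \<open>2 * pi * ln 1 = 0\<close>, as \<open>r n * w\<close> lies inside the disc.\<close>
  have G_int: "has_bochner_integral lborel (G (r n * w)) (2 * pi * ln 2)" for n
    using has_bochner_integral_diff[OF const
        has_bochner_integral_ln_cmod_circle_noncritical[of 1 "r n * w"]] r[of n] w
    by (simp add: G_def[abs_def] norm_mult right_diff_distrib)
  have le2: "cmod (cis t - v) \<le> 2" if "cmod v \<le> 1" for t v
    using norm_triangle_ineq4[of "cis t" v] that by simp
  have G_nonneg: "0 \<le> G v t" if "cmod v \<le> 1" for v t
  proof (cases "cis t = v")
    case False
    then have "ln (cmod (cis t - v)) \<le> ln 2"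
      using le2[OF that, of t] by (subst ln_le_cancel_iff) auto
    then show ?thesis by (simp add: G_def)
  qed (simp add: G_def)
  have rw: "cmod (r n * w) \<le> 1" for n
    using r[of n] w by (simp add: norm_mult)
  have cis_ne: "cis t \<noteq> r n * w" for n t
  proof
    assume "cis t = r n * w"
    then have "1 = r n"
      using r[of n] w by (metis abs_of_pos mult.right_neutral norm_cis norm_mult norm_of_real)
    then show False using r[of n] by simp
  qed
  have lim: "AE t in lborel. (\<lambda>n. G (r n * w) t) \<longlonglongrightarrow> G w t"
    using AE_cis_neq[of w]
  proof eventually_elim
    case (elim t)
    show ?case
    proof (cases "t \<in> {0..2 * pi}")
      case True
      with elim have ne: "cmod (cis t - of_real 1 * w) \<noteq> 0" by auto
      have "(\<lambda>n. ln 2 - ln (cmod (cis t - of_real (r n) * w)))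
          \<longlonglongrightarrow> ln 2 - ln (cmod (cis t - of_real 1 * w))"
        by (intro tendsto_intros r_lim ne)
      then show ?thesis using True by (simp add: G_def)
    qed (simp add: G_def)
  qed
  have dom: "AE t in lborel. norm (G (r n * w) t) \<le> G w t + indicator {0..2 * pi} t *\<^sub>R ln 2" for n
    using AE_cis_neq[of w]
  proof eventually_elim
    case (elim t)
    show ?case
    proof (cases "t \<in> {0..2 * pi}")
      case True
      with elim have ne: "cis t \<noteq> w" by auto
      \<comment> \<open>The point \<open>r n * w\<close> is at distance \<open>1 - r n\<close> from
        \<open>w\<close>, and no point of the unit circle is nearer to it.\<close>
      have "cmod (cis t - w) \<le> cmod (cis t - r n * w) + cmod (r n * w - w)"
        using norm_triangle_ineq[of "cis t - r n * w" "r n * w - w"] by simp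
      also have "cmod (r n * w - w) = 1 - r n"
      proof -
        have "r n * w - w = - (of_real (1 - r n) * w)" by (simp add: algebra_simps)
        then show ?thesis using r[of n] w by (simp only: norm_minus_cancel norm_mult norm_of_real) simp
      qed
      also have "1 - r n \<le> cmod (cis t - r n * w)"
        using norm_triangle_ineq2[of "cis t" "r n * w"] r[of n] w by (simp add: norm_mult)
      finally have "cmod (cis t - w) \<le> 2 * cmod (cis t - r n * w)" by simp
      then have "ln (cmod (cis t - w)) \<le> ln (2 * cmod (cis t - r n * w))"
        using ne cis_ne[of t n] by (subst ln_le_cancel_iff) auto
      then show ?thesis
        using True cis_ne[of t n] G_nonneg[OF rw[of n], of t] by (simp add: G_def ln_mult)
    qed (simp add: G_def)
  qed
  have "(\<integral>\<^sup>+t. ennreal (G w t) \<partial>lborel) = (\<integral>\<^sup>+t. liminf (\<lambda>n. ennreal (G (r n * w) t)) \<partial>lborel)"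
  proof (rule nn_integral_cong_AE, use lim in eventually_elim)
    case (elim t)
    then have "(\<lambda>n. ennreal (G (r n * w) t)) \<longlonglongrightarrow> ennreal (G w t)"
      by (rule tendsto_ennrealI)
    then show ?case by (simp add: lim_imp_Liminf)
  qed
  also have "\<dots> \<le> liminf (\<lambda>n. \<integral>\<^sup>+t. ennreal (G (r n * w) t) \<partial>lborel)"
    by (intro nn_integral_liminf) measurable
  also have "\<dots> = ennreal (2 * pi * ln 2)"
    using G_int G_nonneg[OF rw] by (simp add: nn_integral_eq_integral has_bochner_integral_iff Liminf_const)
  finally have "integrable lborel (G w)"
    using w by (intro integrableI_nonneg) (auto simp: G_nonneg le_less_trans)
  moreover from this
  have "(\<lambda>n. integral\<^sup>L lborel (G (r n * w))) \<longlonglongrightarrow> integral\<^sup>L lborel (G w)"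
    by (intro integral_dominated_convergence[OF _ _ _ lim dom] Bochner_Integration.integrable_add
        integrable.intros[OF const]) auto
  then have "integral\<^sup>L lborel (G w) = 2 * pi * ln 2"
    using G_int by (simp add: has_bochner_integral_iff LIMSEQ_const_iff)
  ultimately have "has_bochner_integral lborel (G w) (2 * pi * ln 2)"
    by (simp add: has_bochner_integral_iff)
  from has_bochner_integral_diff[OF const this]
  show ?thesis by (simp add: G_def right_diff_distrib)
qed

lemma has_bochner_integral_ln_cmod_unit_circle:
  "has_bochner_integral lborel
    (\<lambda>t. indicator {0..2 * pi} t *\<^sub>R ln (cmod (cis t - w))) (2 * pi * ln (max 1 (cmod w)))"
  using has_bochner_integral_ln_cmod_circle_noncritical[of 1 w]
    has_bochner_integral_ln_cmod_unit_circle_critical[of w]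
  by (cases "cmod w = 1") auto

section \<open>Logarithmic integrals over the unit disc\<close>

text \<open>The mean of \<open>ln (cmod (z - w))\<close> over the unit disc, as a function of \<open>\<rho> = cmod w\<close>.\<close>

definition disc_log_mean :: "real \<Rightarrow> real" where
  "disc_log_mean \<rho> = (if 1 \<le> \<rho> then ln \<rho> else (\<rho>\<^sup>2 - 1) / 2)"

lemma emeasure_ball_complex:
  "0 \<le> r \<Longrightarrow> emeasure lborel (ball (z :: complex) r) = ennreal (pi * r\<^sup>2)"
  using emeasure_ball[of r z] by (simp add: unit_ball_vol_2)

lemma has_bochner_integral_unit_disc_const:
  fixes c :: real
  shows "has_bochner_integral lborel (\<lambda>z. indicator (ball (0::complex) 1) z *\<^sub>R c) (pi * c)"
  using has_bochner_integral_mult_left[OF has_bochner_integral_real_indicator[of "ball (0::complex) 1" lborel], of c]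
  by (simp add: emeasure_ball_complex measure_def)

lemma nn_integral_inverse_Icc:
  assumes "0 < m" "m \<le> 1"
  shows "(\<integral>\<^sup>+s. ennreal (1 / s) * indicator {m..1} s \<partial>lborel) = ennreal (- ln m)"
proof -
  have "(\<integral>\<^sup>+s. ennreal (1 / s) * indicator {m..1} s \<partial>lborel) = ennreal (ln 1 - ln m)"
    using assms by (intro nn_integral_FTC_Icc) (auto intro!: derivative_eq_intros)
  then show ?thesis by simp
qed

text \<open>Layer cake: for \<open>0 < m \<le> 1\<close>, \<open>- ln m\<close> is the integral of \<open>1 / s\<close> over \<open>{m..1}\<close>, and the disc
  \<open>cmod z \<le> s\<close> has area \<open>pi * s\<^sup>2\<close>.\<close>

lemma has_bochner_integral_ln_max_unit_disc:
  assumes \<rho>: "0 \<le> \<rho>"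
  shows "has_bochner_integral lborel
    (\<lambda>z::complex. indicator (ball 0 1) z *\<^sub>R ln (max (cmod z) \<rho>)) (pi * disc_log_mean \<rho>)"
proof (cases "1 \<le> \<rho>")
  case True
  have "(\<lambda>z::complex. indicator (ball 0 1) z *\<^sub>R ln (max (cmod z) \<rho>))
      = (\<lambda>z. indicator (ball 0 1) z *\<^sub>R ln \<rho>)"
    using True by (auto simp: fun_eq_iff indicator_def max_def)
  then show ?thesis
    using has_bochner_integral_unit_disc_const[of "ln \<rho>"] True by (simp add: disc_log_mean_def)
next
  case False
  let ?D = "ball (0::complex) 1"
  have "(\<integral>\<^sup>+z. ennreal (- (indicator ?D z *\<^sub>R ln (max (cmod z) \<rho>))) \<partial>lborel)
      = (\<integral>\<^sup>+z. (\<integral>\<^sup>+s. ennreal (1 / s) * indicator {\<rho>..1} s * indicator {z. cmod z \<le> s \<and> cmod z < 1} z \<partial>lborel) \<partial>lborel)"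
  \<comment> \<open>The origin is left out because for \<open>\<rho> = 0\<close> the maximum
    vanishes there.\<close>
  proof (rule nn_integral_cong_AE, use AE_lborel_singleton[of 0] in eventually_elim)
    case (elim z)
    show ?case
    proof (cases "cmod z < 1")
      case True
      then have m: "0 < max (cmod z) \<rho>" "max (cmod z) \<rho> \<le> 1"
        using elim False True by (auto simp: less_max_iff_disj)
      have "ennreal (- ln (max (cmod z) \<rho>))
          = (\<integral>\<^sup>+s. ennreal (1 / s) * indicator {max (cmod z) \<rho>..1} s \<partial>lborel)"
        using nn_integral_inverse_Icc[OF m] by simp
      also have "\<dots> = (\<integral>\<^sup>+s. ennreal (1 / s) * indicator {\<rho>..1} s * indicator {z. cmod z \<le> s \<and> cmod z < 1} z \<partial>lborel)"
        using True by (intro nn_integral_cong) (auto split: split_indicator)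
      finally show ?thesis using True by simp
    qed (simp add: indicator_def)
  qed
  also have "\<dots> = (\<integral>\<^sup>+s. (\<integral>\<^sup>+z. ennreal (1 / s) * indicator {\<rho>..1} s * indicator {z. cmod z \<le> s \<and> cmod z < 1} z \<partial>lborel) \<partial>lborel)"
  proof (intro lborel_pair.Fubini')
    have [measurable]: "(\<lambda>p. indicator {z. cmod z \<le> fst p \<and> cmod z < 1} (snd p) :: ennreal)
        \<in> borel_measurable (lborel \<Otimes>\<^sub>M lborel)"
      unfolding indicator_def by measurable
    show "(\<lambda>(s, z). ennreal (1 / s) * indicator {\<rho>..1} s * indicator {z. cmod z \<le> s \<and> cmod z < 1} z)
        \<in> borel_measurable (lborel \<Otimes>\<^sub>M lborel)"
      unfolding case_prod_beta by measurable
  qed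
  also have "\<dots> = (\<integral>\<^sup>+s. ennreal (pi * s) * indicator {\<rho>..1} s \<partial>lborel)"
  \<comment> \<open>For \<open>s < 1\<close> the condition \<open>cmod z < 1\<close> follows from
    \<open>cmod z \<le> s\<close>, so the section is a closed disc. The product of
    \<open>1 / s\<close> and its area is \<open>pi * s\<close>, also at \<open>s = 0\<close>, where
    \<open>1 / s\<close> is 0 in HOL.\<close>
  proof (rule nn_integral_cong_AE, use AE_lborel_singleton[of 1] in eventually_elim)
    case (elim s)
    show ?case
    proof (cases "s \<in> {\<rho>..1}")
      case True
      then have s: "0 \<le> s" "s < 1" using elim \<rho> by auto
      then have "{z::complex. cmod z \<le> s \<and> cmod z < 1} = cball 0 s" by auto
      then have "emeasure lborel {z::complex. cmod z \<le> s \<and> cmod z < 1} = ennreal (pi * s\<^sup>2)"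
        using emeasure_cball[of s "0::complex"] s by (simp add: unit_ball_vol_2)
      moreover have "{z::complex. cmod z \<le> s \<and> cmod z < 1} \<in> sets lborel" by measurable
      ultimately show ?thesis
        using True s
        by (simp add: nn_integral_cmult_indicator ennreal_mult[symmetric] power2_eq_square)
    qed simp
  qed
  also have "\<dots> = ennreal (pi * 1\<^sup>2 / 2 - pi * \<rho>\<^sup>2 / 2)"
    using \<rho> False by (intro nn_integral_FTC_Icc) (auto intro!: derivative_eq_intros)
  also have "\<dots> = ennreal (- (pi * disc_log_mean \<rho>))"
    using False by (intro arg_cong[where f=ennreal]) (simp add: disc_log_mean_def field_simps)
  finally have eq: "(\<integral>\<^sup>+z. ennreal (- (indicator ?D z *\<^sub>R ln (max (cmod z) \<rho>))) \<partial>lborel)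
      = ennreal (- (pi * disc_log_mean \<rho>))" .
  have nonneg: "0 \<le> - (indicator ?D z *\<^sub>R ln (max (cmod z) \<rho>))" for z
    using False \<rho> by (cases "max (cmod z) \<rho> = 0") (auto simp: indicator_def less_max_iff_disj intro!: ln_le_zero_iff[THEN iffD2])
  have "0 \<le> - disc_log_mean \<rho>"
    using False \<rho> by (simp add: disc_log_mean_def power_le_one)
  moreover have "(\<lambda>z. - (indicator ?D z *\<^sub>R ln (max (cmod z) \<rho>))) \<in> borel_measurable lborel"
  proof -
    have [measurable]: "?D \<in> sets borel" by simp
    show ?thesis by measurable
  qed
  ultimately have "has_bochner_integral lborel
      (\<lambda>z. - (indicator ?D z *\<^sub>R ln (max (cmod z) \<rho>))) (- (pi * disc_log_mean \<rho>))"
    by (intro has_bochner_integral_nn_integral eq AE_I2 nonneg)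
      (simp_all add: mult_nonneg_nonpos)
  from has_bochner_integral_minus[OF this] show ?thesis by simp
qed

lemma AE_cmod_neq: "AE z in lborel. cmod z \<noteq> r"
proof -
  have "sphere (0::complex) r \<in> null_sets lborel"
    using negligible_sphere[of "0::complex" r] by (simp add: negligible_iff_null_sets null_sets_completion_iff)
  then have "AE z in lborel. z \<notin> sphere (0::complex) r" by (rule AE_not_in)
  then show ?thesis by eventually_elim auto
qed

text \<open>Since rotations preserve area, the logarithm may first be averaged over circles about the
  origin; this replaces \<open>cmod (z - w)\<close> by \<open>max (cmod z) (cmod w)\<close>.\<close>

lemma has_bochner_integral_ln_cmod_unit_disc:
  "has_bochner_integral lborel
    (\<lambda>z. indicator (ball 0 1) z *\<^sub>R ln (cmod (z - w))) (pi * disc_log_mean (cmod w))"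
proof -
  let ?D = "ball (0::complex) 1" and ?I = "{0..2 * pi}"
  \<comment> \<open>On the disc both \<open>cmod (z - w)\<close> and
    \<open>max (cmod z) (cmod w)\<close> are at most \<open>1 + cmod w\<close>. Hence
    \<open>F\<close> and \<open>G\<close> are nonnegative, and the order of integration may be
    exchanged before integrability of \<open>F\<close> is known.\<close>
  define K where "K = ln (1 + cmod w)"
  define F where "F z = indicator ?D z *\<^sub>R (K - ln (cmod (z - w)))" for z
  define G where "G z = indicator ?D z *\<^sub>R (K - ln (max (cmod z) (cmod w)))" for z
  have [measurable]: "cis \<in> borel_measurable borel"
    by (intro borel_measurable_continuous_onI continuous_intros)
  have [measurable]: "?D \<in> sets borel" by simp
  have [measurable]: "F \<in> borel_measurable borel"
    unfolding F_def[abs_def] by measurable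
  have K_nonneg: "0 \<le> K" by (simp add: K_def)
  have ln_le_K: "ln x \<le> K" if "x \<le> 1 + cmod w" "0 \<le> x" for x
    using that K_nonneg by (cases "x = 0") (auto simp: K_def add_pos_nonneg)
  have F_nonneg: "0 \<le> F z" for z
    using ln_le_K[of "cmod (z - w)"] norm_triangle_ineq4[of z w]
    by (auto simp: F_def indicator_def)
  have G_nonneg: "0 \<le> G z" for z
  proof (cases "z \<in> ?D")
    case True
    then have "max (cmod z) (cmod w) \<le> 1 + cmod w" by (auto intro: add_increasing2)
    then show ?thesis using ln_le_K True by (simp add: G_def le_max_iff_disj)
  qed (simp add: G_def)
  have G_int: "has_bochner_integral lborel G (pi * K - pi * disc_log_mean (cmod w))"
    using has_bochner_integral_diff[OF has_bochner_integral_unit_disc_const[of K]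
        has_bochner_integral_ln_max_unit_disc[of "cmod w"]]
    by (simp add: G_def[abs_def] right_diff_distrib)
  \<comment> \<open>Leaving out the null circle \<open>cmod z = cmod w\<close> makes the noncritical
    circle integral applicable.\<close>
  have circle: "AE z in lborel. (\<integral>\<^sup>+t. ennreal (F (z * cis t)) * indicator ?I t \<partial>lborel) = ennreal (2 * pi) * ennreal (G z)"
    using AE_cmod_neq[of "cmod w"]
  proof eventually_elim
    case (elim z)
    show ?case
    proof (cases "z \<in> ?D")
      case True
      have "has_bochner_integral lborel
          (\<lambda>t. indicator ?I t *\<^sub>R K - indicator ?I t *\<^sub>R ln (cmod (z * cis t - w)))
          (2 * pi * K - 2 * pi * ln (max (cmod z) (cmod w)))"
        using has_bochner_integral_diff[OF has_bochner_integral_interval_const[of 0 "2 * pi" K]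
            has_bochner_integral_ln_cmod_circle_noncritical[OF elim]] by simp
      moreover have "(\<lambda>t. indicator ?I t *\<^sub>R K - indicator ?I t *\<^sub>R ln (cmod (z * cis t - w)))
          = (\<lambda>t. F (z * cis t) * indicator ?I t)"
        using True by (auto simp: F_def fun_eq_iff indicator_def norm_mult)
      ultimately have int: "has_bochner_integral lborel (\<lambda>t. F (z * cis t) * indicator ?I t) (2 * pi * G z)"
        using True by (simp add: G_def right_diff_distrib)
      have "(\<integral>\<^sup>+t. ennreal (F (z * cis t)) * indicator ?I t \<partial>lborel)
          = (\<integral>\<^sup>+t. ennreal (F (z * cis t) * indicator ?I t) \<partial>lborel)"
        by (intro nn_integral_cong) (simp split: split_indicator)
      also have "\<dots> = ennreal (2 * pi * G z)"
        using int by (subst nn_integral_eq_integral) (auto simp: has_bochner_integral_iff F_nonneg)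
      finally show ?thesis by (simp add: ennreal_mult' G_nonneg)
    qed (simp add: F_def G_def norm_mult)
  qed
  have "ennreal (2 * pi) * (\<integral>\<^sup>+z. ennreal (F z) \<partial>lborel)
      = (\<integral>\<^sup>+t. (\<integral>\<^sup>+z. ennreal (F z) \<partial>lborel) * indicator ?I t \<partial>lborel)"
    by (simp add: nn_integral_cmult mult.commute)
  also have "\<dots> = (\<integral>\<^sup>+t. (\<integral>\<^sup>+z. ennreal (F (z * cis t)) * indicator ?I t \<partial>lborel) \<partial>lborel)"
    by (intro nn_integral_cong) (simp add: nn_integral_multc nn_integral_lborel_rotate[where h = "\<lambda>z. ennreal (F z)"])
  also have "\<dots> = (\<integral>\<^sup>+z. (\<integral>\<^sup>+t. ennreal (F (z * cis t)) * indicator ?I t \<partial>lborel) \<partial>lborel)"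
    by (intro lborel_pair.Fubini') measurable
  also have "\<dots> = (\<integral>\<^sup>+z. ennreal (2 * pi) * ennreal (G z) \<partial>lborel)"
    by (intro nn_integral_cong_AE circle)
  also have "\<dots> = ennreal (2 * pi) * (\<integral>\<^sup>+z. ennreal (G z) \<partial>lborel)"
    using G_int by (intro nn_integral_cmult) (auto simp: has_bochner_integral_iff)
  finally have "(\<integral>\<^sup>+z. ennreal (F z) \<partial>lborel) = (\<integral>\<^sup>+z. ennreal (G z) \<partial>lborel)"
    by (simp add: ennreal_mult_cancel_left)
  also have "\<dots> = ennreal (pi * K - pi * disc_log_mean (cmod w))"
    using G_int by (subst nn_integral_eq_integral) (auto simp: has_bochner_integral_iff G_nonneg)
  finally have "has_bochner_integral lborel F (pi * K - pi * disc_log_mean (cmod w))"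
    using G_int integral_nonneg_AE[of G lborel]
    by (intro has_bochner_integral_nn_integral) (auto simp: F_nonneg G_nonneg has_bochner_integral_iff)
  from has_bochner_integral_diff[OF has_bochner_integral_unit_disc_const[of K] this]
  show ?thesis by (simp add: F_def right_diff_distrib)
qed

section \<open>Comparison of the two contributions of a root\<close>

lemma disc_log_mean_le: "0 \<le> \<rho> \<Longrightarrow> disc_log_mean \<rho> \<le> ln (max 1 \<rho>)"
  by (auto simp: disc_log_mean_def power_le_one)

lemma disc_log_mean_eq: "1 \<le> \<rho> \<Longrightarrow> disc_log_mean \<rho> = ln (max 1 \<rho>)"
  by (simp add: disc_log_mean_def)

text \<open>The slack is \<open>\<rho>\<^sup>2 / 2\<close> for \<open>\<rho> < 1\<close> and
  \<open>1 / 2\<close> for \<open>1 \<le> \<rho>\<close>.\<close>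

lemma disc_log_mean_ge: "ln (max 1 \<rho>) \<le> disc_log_mean \<rho> + 1 / 2"
  by (auto simp: disc_log_mean_def field_simps)

lemma disc_log_mean_eq_lower_iff: "disc_log_mean \<rho> + 1 / 2 = ln (max 1 \<rho>) \<longleftrightarrow> \<rho> = 0"
  by (auto simp: disc_log_mean_def field_simps)

section \<open>Both measures in terms of the roots\<close>

text \<open>The roots are listed with multiplicity. The pointwise form feeds the integrals; the
  polynomial identity serves to recognise monomials.\<close>

lemma complex_poly_roots:
  fixes P :: "complex poly"
  obtains c where "\<And>z. poly P z = lead_coeff P * (\<Prod>i<degree P. z - c i)"
    "P = smult (lead_coeff P) (\<Prod>i<degree P. [:- c i, 1:])"
proof -
  obtain c where c: "smult (lead_coeff P) (\<Prod>i<degree P. [:- c i, 1:]) = P"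
    using complex_poly_decompose' .
  have "poly P z = lead_coeff P * (\<Prod>i<degree P. z - c i)" for z
    by (subst c[symmetric]) (simp add: poly_prod)
  with c that show ?thesis by metis
qed

text \<open>The point \<open>z\<close> has to avoid the roots: since \<open>ln 0 = 0\<close>, the
  logarithm of a product with a zero factor need not be the sum of the logarithms.\<close>

lemma ln_cmod_factored:
  fixes c :: "nat \<Rightarrow> complex"
  assumes "a \<noteq> 0" "\<And>i. i < d \<Longrightarrow> z \<noteq> c i"
  shows "ln (cmod (a * (\<Prod>i<d. z - c i))) = ln (cmod a) + (\<Sum>i<d. ln (cmod (z - c i)))"
proof -
  have "ln (\<Prod>i<d. cmod (z - c i)) = (\<Sum>i<d. ln (cmod (z - c i)))"
    using assms(2) by (intro ln_prod finite_lessThan) auto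
  moreover have "(\<Prod>i<d. cmod (z - c i)) > 0"
    using assms(2) by (intro prod_pos) auto
  ultimately show ?thesis
    using assms by (auto simp: norm_mult ln_mult simp flip: prod_norm)
qed

text \<open>For almost every angle \<open>cis t\<close> is not a root, and the logarithm splits into
  one term per root. Jensen's formula evaluates each term, and \<open>2 * pi\<close>
  cancels.\<close>

lemma mahler_measure_factored:
  assumes "P \<noteq> 0" and P: "\<And>z. poly P z = lead_coeff P * (\<Prod>i<degree P. z - c i)"
  shows "mahler_measure P = exp (ln (cmod (lead_coeff P)) + (\<Sum>i<degree P. ln (max 1 (cmod (c i)))))"
proof -
  let ?I = "{0..2 * pi}" and ?a = "lead_coeff P"
  let ?S = "\<lambda>t. indicator ?I t *\<^sub>R ln (cmod ?a) + (\<Sum>i<degree P. indicator ?I t *\<^sub>R ln (cmod (cis t - c i)))"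
  have [measurable]: "cis \<in> borel_measurable borel"
    by (intro borel_measurable_continuous_onI continuous_intros)
  have "has_bochner_integral lborel ?S
      ((2 * pi - 0) * ln (cmod ?a) + (\<Sum>i<degree P. 2 * pi * ln (max 1 (cmod (c i)))))"
    by (intro has_bochner_integral_add has_bochner_integral_sum has_bochner_integral_interval_const
        has_bochner_integral_ln_cmod_unit_circle) simp
  moreover have "AE t in lborel. ?S t = indicator ?I t *\<^sub>R ln (cmod (poly P (cis t)))"
  proof -
    have "AE t in lborel. \<forall>i\<in>{..<degree P}. t \<in> ?I \<longrightarrow> cis t \<noteq> c i"
      by (intro AE_finite_allI AE_cis_neq) simp
    then show ?thesis
    proof eventually_elim
      case (elim t)
      then show ?case
        using \<open>P \<noteq> 0\<close> by (cases "t \<in> ?I") (simp_all add: P ln_cmod_factored)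
    qed
  qed
  moreover have "(\<lambda>t. indicator ?I t *\<^sub>R ln (cmod (poly P (cis t)))) \<in> borel_measurable lborel"
    unfolding P by measurable
  ultimately have "has_bochner_integral lborel (\<lambda>t. indicator ?I t *\<^sub>R ln (cmod (poly P (cis t))))
      ((2 * pi - 0) * ln (cmod ?a) + (\<Sum>i<degree P. 2 * pi * ln (max 1 (cmod (c i)))))"
    using has_bochner_integralI_AE by blast
  then show ?thesis
    using \<open>P \<noteq> 0\<close>
    by (simp add: mahler_measure_def set_lebesgue_integral_def has_bochner_integral_iff cis_conv_exp
        add_divide_distrib sum_distrib_left[symmetric])
qed

text \<open>The same splitting holds off the finite set of roots in the disc; each term then
  contributes \<open>pi\<close> times its logarithmic mean.\<close>

lemma areal_mahler_measure_factored:
  assumes "P \<noteq> 0" and P: "\<And>z. poly P z = lead_coeff P * (\<Prod>i<degree P. z - c i)"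
  shows "areal_mahler_measure P = exp (ln (cmod (lead_coeff P)) + (\<Sum>i<degree P. disc_log_mean (cmod (c i))))"
proof -
  let ?D = "ball (0::complex) 1" and ?a = "lead_coeff P"
  let ?S = "\<lambda>z. indicator ?D z *\<^sub>R ln (cmod ?a) + (\<Sum>i<degree P. indicator ?D z *\<^sub>R ln (cmod (z - c i)))"
  have [measurable]: "?D \<in> sets borel" by simp
  have "has_bochner_integral lborel ?S
      (pi * ln (cmod ?a) + (\<Sum>i<degree P. pi * disc_log_mean (cmod (c i))))"
    by (intro has_bochner_integral_add has_bochner_integral_sum has_bochner_integral_unit_disc_const
        has_bochner_integral_ln_cmod_unit_disc)
  moreover have "AE z in lborel. ?S z = indicator ?D z *\<^sub>R ln (cmod (poly P z))"
  proof -
    have "AE z in lborel. \<forall>i\<in>{..<degree P}. z \<noteq> c i"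
      by (intro AE_finite_allI AE_lborel_singleton) simp
    then show ?thesis
    proof eventually_elim
      case (elim z)
      then show ?case
        using \<open>P \<noteq> 0\<close> by (cases "z \<in> ?D") (simp_all add: P ln_cmod_factored)
    qed
  qed
  moreover have "(\<lambda>z. indicator ?D z *\<^sub>R ln (cmod (poly P z))) \<in> borel_measurable lborel"
    unfolding P by measurable
  ultimately have "has_bochner_integral lborel (\<lambda>z. indicator ?D z *\<^sub>R ln (cmod (poly P z)))
      (pi * ln (cmod ?a) + (\<Sum>i<degree P. pi * disc_log_mean (cmod (c i))))"
    using has_bochner_integralI_AE by blast
  then show ?thesis
    using \<open>P \<noteq> 0\<close>
    by (simp add: areal_mahler_measure_def set_lebesgue_integral_def has_bochner_integral_iff
        add_divide_distrib sum_distrib_left[symmetric])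
qed

section \<open>The two estimates and their equality cases\<close>

theorem corollary1p2:
  fixes P :: "complex poly" and n :: nat
  assumes "degree P \<le> n"
  shows "exp (- real n / 2) * mahler_measure P \<le> areal_mahler_measure P \<and>
    areal_mahler_measure P \<le> mahler_measure P \<and>
    (exp (- real n / 2) * mahler_measure P = areal_mahler_measure P \<longleftrightarrow> (\<exists>a. P = monom a n)) \<and>
    ((\<forall>z\<in>ball 0 1. poly P z \<noteq> 0) \<longrightarrow> areal_mahler_measure P = mahler_measure P)"
proof (cases "P = 0")
  case True
  \<comment> \<open>The zero polynomial counts as a monomial with coefficient 0, in accordance with
    equality of both sides at 0.\<close>
  then have "P = monom 0 n" by simp
  then show ?thesis
    using True by (auto simp: mahler_measure_def areal_mahler_measure_def)
next
  case False
  define d where "d = degree P"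
  obtain c where poly_P: "\<And>z. poly P z = lead_coeff P * (\<Prod>i<d. z - c i)"
    and P: "P = smult (lead_coeff P) (\<Prod>i<d. [:- c i, 1:])"
    using complex_poly_roots[of P] unfolding d_def by metis
  define L where "L = (\<Sum>i<d. ln (max 1 (cmod (c i))))"
  define A where "A = (\<Sum>i<d. disc_log_mean (cmod (c i)))"
  have mahler: "mahler_measure P = exp (ln (cmod (lead_coeff P)) + L)"
    using mahler_measure_factored[OF False poly_P[unfolded d_def]] by (simp add: L_def d_def)
  have areal: "areal_mahler_measure P = exp (ln (cmod (lead_coeff P)) + A)"
    using areal_mahler_measure_factored[OF False poly_P[unfolded d_def]] by (simp add: A_def d_def)
  have root: "poly P (c i) = 0" if "i < d" for i
    using that by (auto simp: poly_P)
  let ?e = "\<lambda>i. disc_log_mean (cmod (c i)) + 1 / 2 - ln (max 1 (cmod (c i)))"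
  \<comment> \<open>This is the slack of the lower estimate on the logarithmic scale:
    \<open>?e i\<close> for each root and \<open>1 / 2\<close> for each degree that \<open>P\<close>
    falls short of \<open>n\<close>. All terms are nonnegative, so equality forces
    \<open>d = n\<close> and every \<open>?e i = 0\<close>, that is, every root at the
    origin.\<close>
  have gap: "A + real n / 2 - L = (\<Sum>i<d. ?e i) + (real n - real d) / 2"
    by (simp add: A_def L_def sum.distrib sum_subtractf diff_divide_distrib)
  have e_nonneg: "0 \<le> ?e i" for i
    using disc_log_mean_ge[of "cmod (c i)"] by simp
  have d_le: "0 \<le> real n - real d"
    using assms by (simp add: d_def)
  have e_sum: "0 \<le> (\<Sum>i<d. ?e i)"
    by (intro sum_nonneg e_nonneg)
  have lower_exp: "exp (- real n / 2) * mahler_measure P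
      = exp (ln (cmod (lead_coeff P)) + (L - real n / 2))"
    by (simp add: mahler flip: exp_add)
  have "L - real n / 2 \<le> A"
    using add_nonneg_nonneg[OF e_sum, of "(real n - real d) / 2"] d_le unfolding gap[symmetric] by simp
  then have lower: "exp (- real n / 2) * mahler_measure P \<le> areal_mahler_measure P"
    unfolding lower_exp areal by simp
  have "A \<le> L"
    unfolding A_def L_def by (intro sum_mono disc_log_mean_le) simp
  then have upper: "areal_mahler_measure P \<le> mahler_measure P"
    by (simp add: mahler areal)
  have "exp (- real n / 2) * mahler_measure P = areal_mahler_measure P
      \<longleftrightarrow> (\<Sum>i<d. ?e i) + (real n - real d) / 2 = 0"
    unfolding lower_exp areal gap[symmetric] by auto
  also have "\<dots> \<longleftrightarrow> (\<Sum>i<d. ?e i) = 0 \<and> d = n"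
    using add_nonneg_eq_0_iff[OF e_sum, of "(real n - real d) / 2"] d_le by auto
  also have "(\<Sum>i<d. ?e i) = 0 \<longleftrightarrow> (\<forall>i<d. ?e i = 0)"
    by (subst sum_nonneg_eq_0_iff) (use e_nonneg in auto)
  also have "\<dots> \<longleftrightarrow> (\<forall>i<d. c i = 0)"
    using disc_log_mean_eq_lower_iff by simp
  also have "(\<forall>i<d. c i = 0) \<and> d = n \<longleftrightarrow> (\<exists>a. P = monom a n)"
  proof
    assume "(\<forall>i<d. c i = 0) \<and> d = n"
    then have "P = smult (lead_coeff P) ([:0, 1:] ^ n)"
      by (subst P) simp
    then show "\<exists>a. P = monom a n" by (metis monom_altdef)
  next
    assume "\<exists>a. P = monom a n"
    then obtain a where a: "P = monom a n" by blast
    with False have "a \<noteq> 0" by auto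
    then show "(\<forall>i<d. c i = 0) \<and> d = n"
      using root by (auto simp: a d_def degree_monom_eq poly_monom)
  qed
  finally have eq: "exp (- real n / 2) * mahler_measure P = areal_mahler_measure P
      \<longleftrightarrow> (\<exists>a. P = monom a n)" .
  have "areal_mahler_measure P = mahler_measure P" if "\<forall>z\<in>ball 0 1. poly P z \<noteq> 0"
  proof -
    have "1 \<le> cmod (c i)" if "i < d" for i
      using \<open>\<forall>z\<in>ball 0 1. poly P z \<noteq> 0\<close> root[OF that] by (metis mem_ball_0 not_le)
    then have "A = L"
      unfolding A_def L_def by (intro sum.cong disc_log_mean_eq) auto
    then show ?thesis by (simp add: mahler areal)
  qed
  with lower upper eq show ?thesis by blast
qed

end
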